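(* Let $\Gamma=G(\mathbb{Z}_n,\mathcal{C})$ be a connected oriented circulant graph with $n\equiv 0\pmod 4$, where every element of $\mathcal{C}$ is odd. Then: (i) If $n\equiv 4\pmod 8$, the real part of $(E_{\theta_i})_{n/4,0}$ is zero for every eigenvalue $\theta_i$ of $\Gamma$. Zero transfer occurs between $n/4$ and $0$ if and only if $|M_{\theta_i}\cap(4\mathbb{Z}+1)|=|M_{\theta_i}\cap(4\mathbb{Z}+3)|$ for every eigenvalue $\theta_i$. (ii) If $n\equiv 0\pmod 8$, the imaginary part of $(E_{\theta_i})_{n/4,0}$ is zero for every eigenvalue $\theta_i$ of $\Gamma$. Zero transfer occurs between $n/4$ and $0$ if and only if $|M_{\theta_i}\cap 4\mathbb{Z}|=|M_{\theta_i}\cap(4\mathbb{Z}+2)|$ for every eigenvalue $\theta_i$.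
   Context: For $\mathcal{C}\subseteq\mathbb{Z}_n\setminus\{0\}$, the circulant graph $G(\mathbb{Z}_n,\mathcal{C})$ has vertex set $\mathbb{Z}_n$ and arc set $\{(a,b): b-a\in\mathcal{C},\ a,b\in\mathbb{Z}_n\}$; it is an oriented circulant graph if $\mathcal{C}\cap\mathcal{C}^{-1}=\emptyset$, where $\mathcal{C}^{-1}=\{-c: c\in\mathcal{C}\}$. Connected means that the underlying undirected graph is connected. Its Hermitian adjacency matrix $H$ has $H_{a,b}=\mathrm{i}$ if $b-a\in\mathcal{C}$, $H_{a,b}=-\mathrm{i}$ if $a-b\in\mathcal{C}$, and $H_{a,b}=0$ otherwise, where $\mathrm{i}=\sqrt{-1}$; the eigenvalues of $\Gamma$ are those of $H$. With $\omega_n=\exp(2\pi\mathrm{i}/n)$, the eigenvalues of $H$, listed with multiplicity, are $\mu_j=\mathrm{i}\sum_{k\in\mathcal{C}}(\omega_n^{jk}-\omega_n^{-jk})=-2\sum_{k\in\mathcal{C}}\sin(2\pi jk/n)$ for $j=0,1,\ldots,n-1$, with eigenvectors $(1,\omega_n^j,\ldots,\omega_n^{(n-1)j})^\top$. For an eigenvalue $\theta$, $E_\theta$ is the orthogonal projection onto the $\theta$-eigenspace of $H$ (spectral idempotent), and the index set is $M_\theta=\{j\in\mathbb{Z}_n:\mu_j=\theta\}$; since $4\mid n$, residues modulo $4$ of elements of $\mathbb{Z}_n$ are well defined, and $M_\theta\cap(4\mathbb{Z}+c)$ is the set of elements of $M_\theta$ congruent to $c$ modulo $4$. The transition matrix is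 $U(t)=\exp(-\mathrm{i}tH)$, $t\in\mathbb{R}$. There is zero transfer between vertices $u$ and $v$ if $U(t)_{u,v}=0$ for all $t\ge 0$ (this condition is symmetric in $u$ and $v$). *)

theory Defs
  imports
    "HOL-Analysis.Analysis"
    "Jordan_Normal_Form.Char_Poly"
    "Jordan_Normal_Form.Conjugate"
    "Graph_Theory.Digraph_Component"
begin

text \<open>The elements of \<open>\<int>\<^sub>n\<close> are represented by the naturals below \<open>n\<close>.\<close>

definition zn_diff :: "nat \<Rightarrow> nat \<Rightarrow> nat \<Rightarrow> nat" where
  "zn_diff n b a = nat ((int b - int a) mod int n)"

definition zn_uminus_set :: "nat \<Rightarrow> nat set \<Rightarrow> nat set" where
  "zn_uminus_set n C = (\<lambda>c. zn_diff n 0 c) ` C"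

definition circulant_graph :: "nat \<Rightarrow> nat set \<Rightarrow> nat pair_pre_digraph" where
  "circulant_graph n C =
     \<lparr> pverts = {0..<n}, parcs = {(a, b). a < n \<and> b < n \<and> zn_diff n b a \<in> C} \<rparr>"

text \<open>The constant \<^const>\<open>Digraph_Component.connected\<close> (qualified because of topological
  connectedness) is connectedness of the underlying undirected graph.\<close>

definition connected_oriented_circulant :: "nat \<Rightarrow> nat set \<Rightarrow> bool" where
  "connected_oriented_circulant n C \<longleftrightarrow>
     0 < n \<and> C \<subseteq> {0..<n} - {0} \<and> C \<inter> zn_uminus_set n C = {} \<and>
     Digraph_Component.connected (with_proj (circulant_graph n C))"

definition hermitian_adj :: "nat \<Rightarrow> nat set \<Rightarrow> complex mat" where
  "hermitian_adj n C = mat n n (\<lambda>(a, b).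
     if zn_diff n b a \<in> C then \<i> else if zn_diff n a b \<in> C then - \<i> else 0)"

definition root_of_unity :: "nat \<Rightarrow> complex" where
  "root_of_unity n = exp (2 * of_real pi * \<i> / of_nat n)"

definition circ_ev :: "nat \<Rightarrow> nat set \<Rightarrow> nat \<Rightarrow> complex" where
  "circ_ev n C j =
     \<i> * (\<Sum>k\<in>C. root_of_unity n ^ (j * k) - inverse (root_of_unity n ^ (j * k)))"

definition index_set :: "nat \<Rightarrow> nat set \<Rightarrow> complex \<Rightarrow> nat set" where
  "index_set n C \<theta> = {j \<in> {0..<n}. circ_ev n C j = \<theta>}"

definition eigenspace :: "complex mat \<Rightarrow> complex \<Rightarrow> complex vec set" where
  "eigenspace A \<theta> = {v \<in> carrier_vec (dim_row A). A *\<^sub>v v = \<theta> \<cdot>\<^sub>v v}"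

definition is_orth_projection :: "nat \<Rightarrow> complex vec set \<Rightarrow> complex mat \<Rightarrow> bool" where
  "is_orth_projection n V P \<longleftrightarrow>
     P \<in> carrier_mat n n \<and>
     (\<forall>v \<in> carrier_vec n. P *\<^sub>v v \<in> V \<and> (\<forall>w \<in> V. (v - P *\<^sub>v v) \<bullet>c w = 0))"

definition spectral_idempotent :: "complex mat \<Rightarrow> complex \<Rightarrow> complex mat" where
  "spectral_idempotent A \<theta> = (THE P. is_orth_projection (dim_row A) (eigenspace A \<theta>) P)"

text \<open>The exponential series of a square matrix, summed entrywise.\<close>

definition mat_exp :: "complex mat \<Rightarrow> complex mat" where
  "mat_exp A = mat (dim_row A) (dim_row A) (\<lambda>(a, b). \<Sum>k. (A ^\<^sub>m k) $$ (a, b) / fact k)"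

definition transition_mat :: "complex mat \<Rightarrow> real \<Rightarrow> complex mat" where
  "transition_mat H t = mat_exp ((- \<i> * of_real t) \<cdot>\<^sub>m H)"

definition zero_transfer :: "complex mat \<Rightarrow> nat \<Rightarrow> nat \<Rightarrow> bool" where
  "zero_transfer H u v \<longleftrightarrow> (\<forall>t\<ge>0. transition_mat H t $$ (u, v) = 0)"

end

theory Submission
  imports Defs
begin

text \<open>
  A matrix whose \<open>(a, b)\<close> entry is \<open>1/n \<Sum>\<^sub>j f j \<omega>\<^sub>n^(j(a - b))\<close> is diagonalised by the characters of
  \<open>\<int>\<^sub>n\<close>, so such matrices multiply like the functions \<open>f\<close>.  The Hermitian adjacency matrix belongs to
  \<open>f j = \<mu>\<^sub>j\<close>, its idempotent at \<open>\<theta>\<close> to the indicator of \<open>M\<^sub>\<theta>\<close>, and \<open>U(t)\<close> to \<open>exp (-i t \<mu>\<^sub>j)\<close>.  At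
  \<open>(n/4, 0)\<close> the characters become powers of \<open>\<i>\<close>, so \<open>n\<close> times that entry of \<open>E\<^sub>\<theta>\<close> has real part \<open>N\<^sub>0 - N\<^sub>2\<close> and imaginary
  part \<open>N\<^sub>1 - N\<^sub>3\<close>, where \<open>N\<^sub>c\<close> counts the elements of \<open>M\<^sub>\<theta>\<close> congruent to \<open>c\<close> modulo 4.  As all
  connection elements are odd, the reflection \<open>j \<mapsto> n/2 - j\<close> preserves \<open>M\<^sub>\<theta>\<close>; it swaps the classes 0 and 2
  if \<open>n \<equiv> 4 (mod 8)\<close>, and 1 and 3 if \<open>8\<close> divides \<open>n\<close>.  Finally, distinct exponentials are linearly
  independent on \<open>t \<ge> 0\<close>, so zero transfer means that this entry of every \<open>E\<^sub>\<theta>\<close> vanishes.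
\<close>

section \<open>Characters of the cyclic group and their orthogonality\<close>

text \<open>The integer argument allows differences and negatives of vertices without reduction;
  \<open>zn_char_cong\<close> supplies the periodicity.\<close>

definition zn_char :: "nat \<Rightarrow> int \<Rightarrow> complex" where
  "zn_char n x = cis (2 * pi * real_of_int x / real n)"

lemma zn_char_0 [simp]: "zn_char n 0 = 1"
  by (simp add: zn_char_def)

lemma zn_char_add: "zn_char n (x + y) = zn_char n x * zn_char n y"
  by (simp add: zn_char_def cis_mult distrib_left add_divide_distrib)

lemma zn_char_uminus: "zn_char n (- x) = inverse (zn_char n x)"
  by (simp add: zn_char_def)

lemma cnj_zn_char: "cnj (zn_char n x) = zn_char n (- x)"
  by (simp add: zn_char_def cis_cnj)

lemma zn_char_power: "zn_char n x ^ k = zn_char n (int k * x)"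
  by (induction k) (simp_all add: zn_char_add algebra_simps)

lemma zn_char_eq_1_iff:
  assumes "n > 0"
  shows "zn_char n x = 1 \<longleftrightarrow> int n dvd x"
proof
  assume "zn_char n x = 1"
  then have "cos (2 * pi * real_of_int x / real n) = 1"
    by (simp add: zn_char_def complex_eq_iff)
  then obtain m :: int where "2 * pi * real_of_int x / real n = of_int m * 2 * pi"
    using cos_one_2pi_int by auto
  then have "real_of_int x = of_int m * real n"
    using assms by (simp add: field_simps)
  then have "x = m * int n"
    by (metis of_int_eq_iff of_int_mult of_int_of_nat_eq)
  then show "int n dvd x" by simp
next
  assume "int n dvd x"
  then obtain m where "x = int n * m" by blast
  with assms have "2 * pi * real_of_int x / real n = 2 * pi * of_int m" by simp
  then show "zn_char n x = 1"
    by (simp add: zn_char_def cis_multiple_2pi)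
qed

lemma zn_char_cong:
  assumes "n > 0" "int n dvd x - y"
  shows "zn_char n x = zn_char n y"
  using zn_char_add[of n y "x - y"] zn_char_eq_1_iff[OF assms(1), of "x - y"] assms(2) by simp

text \<open>A geometric series whose ratio \<open>zn_char n d\<close> is an n-th root of unity: it
  vanishes unless the ratio is 1.\<close>

lemma sum_zn_char:
  assumes "n > 0"
  shows "(\<Sum>j<n. zn_char n (int j * d)) = (if int n dvd d then of_nat n else 0)"
proof -
  have pow: "zn_char n (int j * d) = zn_char n d ^ j" for j
    by (simp add: zn_char_power)
  have "zn_char n d ^ n = 1"
    using zn_char_eq_1_iff[OF assms, of "int n * d"] by (simp add: zn_char_power)
  then show ?thesis
    using zn_char_eq_1_iff[OF assms, of d] geometric_sum[of "zn_char n d" n]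
    by (cases "int n dvd d") (simp_all add: pow)
qed

lemma root_of_unity_power: "root_of_unity n ^ m = zn_char n (int m)"
proof -
  have "root_of_unity n = zn_char n 1"
    by (simp add: root_of_unity_def zn_char_def cis_conv_exp mult_ac)
  then show ?thesis by (simp add: zn_char_power)
qed

lemma circ_ev_zn_char:
  "circ_ev n C j = \<i> * (\<Sum>k\<in>C. zn_char n (int j * int k) - zn_char n (- (int j * int k)))"
  by (simp add: circ_ev_def root_of_unity_power zn_char_uminus)

section \<open>The algebra of matrices diagonalised by the characters\<close>

text \<open>This is F D F* with F the unitary discrete Fourier matrix and D the diagonal matrix of
  the values \<open>f j\<close>. Giving the entries directly avoids handling F and D.\<close>

definition fourier_mat :: "nat \<Rightarrow> (nat \<Rightarrow> complex) \<Rightarrow> complex mat" where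
  "fourier_mat n f =
     mat n n (\<lambda>(a, b). (\<Sum>j<n. f j * zn_char n (int j * (int a - int b))) / of_nat n)"

lemma fourier_mat_carrier [simp]: "fourier_mat n f \<in> carrier_mat n n"
  and dim_fourier_mat [simp]: "dim_row (fourier_mat n f) = n" "dim_col (fourier_mat n f) = n"
  by (simp_all add: fourier_mat_def)

lemma index_fourier_mat:
  "a < n \<Longrightarrow> b < n \<Longrightarrow>
     fourier_mat n f $$ (a, b) = (\<Sum>j<n. f j * zn_char n (int j * (int a - int b))) / of_nat n"
  by (simp add: fourier_mat_def)

lemma dvd_diff_below_iff:
  assumes "a < n" "b < n"
  shows "int n dvd int a - int b \<longleftrightarrow> a = b"
  using assms by (metis mod_eq_dvd_iff mod_less of_nat_eq_iff of_nat_mod)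

lemma fourier_mat_one:
  assumes "n > 0"
  shows "fourier_mat n (\<lambda>_. 1) = 1\<^sub>m n"
proof (rule eq_matI)
  fix a b assume "a < dim_row (1\<^sub>m n :: complex mat)" "b < dim_col (1\<^sub>m n :: complex mat)"
  then have "a < n" "b < n" by auto
  then show "fourier_mat n (\<lambda>_. 1) $$ (a, b) = 1\<^sub>m n $$ (a, b)"
    using assms by (simp add: index_fourier_mat sum_zn_char dvd_diff_below_iff)
qed simp_all

text \<open>Summing over the intermediate vertex \<open>c\<close> first leaves, by orthogonality of
  the characters, only the terms with \<open>l = j\<close>.\<close>

lemma fourier_mat_mult:
  assumes "n > 0"
  shows "fourier_mat n f * fourier_mat n g = fourier_mat n (\<lambda>j. f j * g j)"
proof (rule eq_matI)
  fix a b assume "a < dim_row (fourier_mat n (\<lambda>j. f j * g j))"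
    "b < dim_col (fourier_mat n (\<lambda>j. f j * g j))"
  then have ab: "a < n" "b < n" by auto
  let ?e = "zn_char n"
  \<comment> \<open>The regrouping confines \<open>c\<close> to one character, which
    \<open>sum_zn_char\<close> can then sum.\<close>
  have ch: "?e (int j * (int a - int c)) * ?e (int l * (int c - int b))
      = ?e (int j * int a - int l * int b) * ?e (int c * (int l - int j))" for j l c
    by (simp add: zn_char_add[symmetric] algebra_simps)
  have "(fourier_mat n f * fourier_mat n g) $$ (a, b)
      = (\<Sum>c<n. ((\<Sum>j<n. f j * ?e (int j * (int a - int c))) / of_nat n)
            * ((\<Sum>l<n. g l * ?e (int l * (int c - int b))) / of_nat n))"
    using ab by (simp add: scalar_prod_def index_fourier_mat lessThan_atLeast0)
  also have "\<dots> = (\<Sum>c<n. \<Sum>j<n. \<Sum>l<n. f j * g l *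
        (?e (int j * (int a - int c)) * ?e (int l * (int c - int b)))) / (of_nat n)\<^sup>2"
    by (simp add: sum_product sum_divide_distrib power2_eq_square mult_ac)
  also have "(\<Sum>c<n. \<Sum>j<n. \<Sum>l<n. f j * g l *
        (?e (int j * (int a - int c)) * ?e (int l * (int c - int b))))
      = (\<Sum>j<n. \<Sum>l<n. \<Sum>c<n. f j * g l *
        (?e (int j * int a - int l * int b) * ?e (int c * (int l - int j))))"
    unfolding ch
    by (rule trans[OF sum.swap], rule sum.cong[OF refl], rule sum.swap)
  also have "\<dots> = (\<Sum>j<n. \<Sum>l<n. f j * g l * ?e (int j * int a - int l * int b)
        * (if l = j then of_nat n else 0))"
  proof (intro sum.cong refl)
    fix j l assume "j \<in> {..<n}" "l \<in> {..<n}"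
    then have "(\<Sum>c<n. ?e (int c * (int l - int j))) = (if l = j then of_nat n else 0)"
      by (simp add: sum_zn_char[OF assms] dvd_diff_below_iff)
    then show "(\<Sum>c<n. f j * g l *
        (?e (int j * int a - int l * int b) * ?e (int c * (int l - int j))))
      = f j * g l * ?e (int j * int a - int l * int b) * (if l = j then of_nat n else 0)"
      by (simp only: mult.assoc sum_distrib_left[symmetric])
  qed
  also have "\<dots> = of_nat n * (\<Sum>j<n. f j * g j * ?e (int j * (int a - int b)))"
  proof -
    have "(\<Sum>l<n. F l * (if l = j then of_nat n else 0)) = of_nat n * F j"
      if "j < n" for j and F :: "nat \<Rightarrow> complex"
      using that by (simp add: if_distrib[where f = "\<lambda>x. _ * x"] cong: if_cong)
    then show ?thesis
      by (simp add: sum_distrib_left right_diff_distrib)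
  qed
  finally show "(fourier_mat n f * fourier_mat n g) $$ (a, b)
      = fourier_mat n (\<lambda>j. f j * g j) $$ (a, b)"
    using ab assms by (simp add: index_fourier_mat power2_eq_square)
qed simp_all

lemma fourier_mat_smult: "c \<cdot>\<^sub>m fourier_mat n f = fourier_mat n (\<lambda>j. c * f j)"
  by (rule eq_matI) (simp_all add: index_fourier_mat sum_distrib_left mult_ac)

lemma fourier_mat_diff: "fourier_mat n f - fourier_mat n g = fourier_mat n (\<lambda>j. f j - g j)"
  by (rule eq_matI)
     (simp_all add: index_fourier_mat sum_subtractf left_diff_distrib diff_divide_distrib)

lemma fourier_mat_power:
  assumes "n > 0"
  shows "fourier_mat n f ^\<^sub>m k = fourier_mat n (\<lambda>j. f j ^ k)"
  by (induction k) (simp_all add: fourier_mat_one fourier_mat_mult assms mult_ac)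

lemma cnj_fourier_mat:
  "a < n \<Longrightarrow> b < n \<Longrightarrow>
     cnj (fourier_mat n f $$ (a, b)) = fourier_mat n (\<lambda>j. cnj (f j)) $$ (b, a)"
  by (simp add: index_fourier_mat cnj_zn_char algebra_simps)

text \<open>The adjoint has the conjugate symbol. For a real symbol, such as an indicator, the
  matrix is therefore self-adjoint, which makes the spectral projections orthogonal.\<close>

lemma fourier_mat_adjoint:
  assumes "x \<in> carrier_vec n" "y \<in> carrier_vec n"
  shows "(fourier_mat n f *\<^sub>v x) \<bullet>c y = x \<bullet>c (fourier_mat n (\<lambda>j. cnj (f j)) *\<^sub>v y)"
proof -
  have "x \<bullet>c (fourier_mat n (\<lambda>j. cnj (f j)) *\<^sub>v y)
      = (\<Sum>a<n. \<Sum>b<n. x $ a * (fourier_mat n f $$ (b, a) * cnj (y $ b)))"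
    using assms
    by (simp add: scalar_prod_def lessThan_atLeast0 cnj_fourier_mat sum_distrib_left)
  also have "\<dots> = (\<Sum>b<n. (\<Sum>a<n. fourier_mat n f $$ (b, a) * x $ a) * cnj (y $ b))"
    by (subst sum.swap) (simp add: sum_distrib_left mult_ac)
  also have "\<dots> = (fourier_mat n f *\<^sub>v x) \<bullet>c y"
    using assms by (simp add: scalar_prod_def lessThan_atLeast0)
  finally show ?thesis ..
qed

text \<open>Powers act pointwise on \<open>f\<close>, so each entry of the matrix series is a finite
  combination of scalar exponential series.\<close>

lemma mat_exp_fourier_mat:
  assumes "n > 0"
  shows "mat_exp (fourier_mat n f) = fourier_mat n (\<lambda>j. exp (f j))"
proof (rule eq_matI)
  fix a b assume "a < dim_row (fourier_mat n (\<lambda>j. exp (f j)))"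
    "b < dim_col (fourier_mat n (\<lambda>j. exp (f j)))"
  then have ab: "a < n" "b < n" by auto
  let ?e = "\<lambda>j. zn_char n (int j * (int a - int b))"
  have "(\<lambda>k. (\<Sum>j<n. (f j ^ k /\<^sub>R fact k) * ?e j) / of_nat n)
      sums ((\<Sum>j<n. exp (f j) * ?e j) / of_nat n)"
    by (intro sums_divide sums_sum sums_mult2 exp_converges)
  then have "(\<lambda>k. fourier_mat n (\<lambda>j. f j ^ k) $$ (a, b) / fact k)
      sums (fourier_mat n (\<lambda>j. exp (f j)) $$ (a, b))"
    using ab by (simp add: index_fourier_mat scaleR_conv_of_real sum_divide_distrib field_simps)
  then show "mat_exp (fourier_mat n f) $$ (a, b) = fourier_mat n (\<lambda>j. exp (f j)) $$ (a, b)"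
    using ab by (simp add: mat_exp_def fourier_mat_power assms sums_iff)
qed (simp_all add: mat_exp_def)

section \<open>The Hermitian adjacency matrix in the character basis\<close>

lemma int_zn_diff: "n > 0 \<Longrightarrow> int (zn_diff n b a) = (int b - int a) mod int n"
  by (simp add: zn_diff_def)

lemma zn_diff_eq_iff:
  assumes "k < n"
  shows "zn_diff n b a = k \<longleftrightarrow> int n dvd int k - (int b - int a)"
proof -
  have "zn_diff n b a = k \<longleftrightarrow> (int b - int a) mod int n = int k"
    using int_zn_diff[of n b a] assms by (metis gr_implies_not0 neq0_conv of_nat_eq_iff)
  also have "\<dots> \<longleftrightarrow> int n dvd int k - (int b - int a)"
    using assms by (metis mod_eq_dvd_iff mod_less of_nat_mod)
  finally show ?thesis .
qed

lemma zn_diff_zero_zn_diff: "n > 0 \<Longrightarrow> zn_diff n 0 (zn_diff n b a) = zn_diff n a b"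
  by (simp add: zn_diff_def mod_minus_eq)

text \<open>Fourier inversion: summing over \<open>j\<close> first turns each of the two characters
  in the eigenvalue formula into n times an indicator, one for \<open>b - a\<close> and one for
  \<open>a - b\<close> lying in \<open>C\<close>.\<close>

lemma hermitian_adj_fourier:
  assumes C: "C \<subseteq> {0..<n}" "C \<inter> zn_uminus_set n C = {}" and n: "n > 0"
  shows "hermitian_adj n C = fourier_mat n (circ_ev n C)"
proof (rule eq_matI)
  fix a b assume "a < dim_row (fourier_mat n (circ_ev n C))"
    "b < dim_col (fourier_mat n (circ_ev n C))"
  then have ab: "a < n" "b < n" by auto
  have fin: "finite C" using C(1) finite_subset by blast
  have ind: "(\<Sum>k\<in>C. if int n dvd int k - (int y - int x) then of_nat n else 0)
      = (if zn_diff n y x \<in> C then of_nat n else (0::complex))" for x y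
  proof -
    have "(\<Sum>k\<in>C. if int n dvd int k - (int y - int x) then of_nat n else 0)
        = (\<Sum>k\<in>C. if zn_diff n y x = k then of_nat n else (0::complex))"
    proof (rule sum.cong[OF refl])
      fix k assume "k \<in> C"
      then have "k < n" using C(1) by auto
      then show "(if int n dvd int k - (int y - int x) then of_nat n else 0)
          = (if zn_diff n y x = k then of_nat n else (0::complex))"
        by (simp only: zn_diff_eq_iff)
    qed
    then show ?thesis using fin by simp
  qed
  have neg: "int n dvd (int a - int b) - int k \<longleftrightarrow> int n dvd int k - (int a - int b)" for k
    by (metis dvd_diff_commute)
  have ch: "circ_ev n C j * zn_char n (int j * (int a - int b)) =
      \<i> * (\<Sum>k\<in>C. zn_char n (int j * (int k - (int b - int a)))
        - zn_char n (int j * ((int a - int b) - int k)))" for j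
    by (simp add: circ_ev_zn_char sum_distrib_left sum_distrib_right left_diff_distrib
        zn_char_add[symmetric] algebra_simps)
  have "(\<Sum>j<n. circ_ev n C j * zn_char n (int j * (int a - int b)))
      = \<i> * (\<Sum>k\<in>C. \<Sum>j<n. zn_char n (int j * (int k - (int b - int a)))
        - zn_char n (int j * ((int a - int b) - int k)))"
    unfolding ch sum_distrib_left[symmetric] by (subst sum.swap) (rule refl)
  also have "\<dots> = \<i> * ((if zn_diff n b a \<in> C then of_nat n else 0)
      - (if zn_diff n a b \<in> C then of_nat n else 0))"
    by (simp only: sum_subtractf sum_zn_char[OF n] neg ind)
  finally have sum: "(\<Sum>j<n. circ_ev n C j * zn_char n (int j * (int a - int b)))
      = \<i> * ((if zn_diff n b a \<in> C then of_nat n else 0)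
      - (if zn_diff n a b \<in> C then of_nat n else 0))" .
  \<comment> \<open>Orientedness enters here: if both differences lay in \<open>C\<close>, the two
    indicators would cancel although the matrix entry would be \<open>\<i>\<close>.\<close>
  have "\<not> (zn_diff n b a \<in> C \<and> zn_diff n a b \<in> C)"
    using C(2) zn_diff_zero_zn_diff[OF n] unfolding zn_uminus_set_def
    by (metis disjoint_iff imageI)
  then show "hermitian_adj n C $$ (a, b) = fourier_mat n (circ_ev n C) $$ (a, b)"
    using ab n by (auto simp: hermitian_adj_def index_fourier_mat sum)
qed (simp_all add: hermitian_adj_def)

section \<open>Eigenvalues and spectral idempotents\<close>

text \<open>Column 0 of the indicator matrix of the fibre of \<open>f j\<close> is an eigenvector.
  It is nonzero because its entry 0 is the size of that fibre divided by n.\<close>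

lemma eigenvalue_fourier_mat:
  assumes "j < n"
  shows "eigenvalue (fourier_mat n f) (f j)"
proof -
  have n: "n > 0" using assms by simp
  let ?P = "fourier_mat n (\<lambda>i. if f i = f j then 1 else 0)"
  let ?v = "?P *\<^sub>v unit_vec n 0"
  have v: "?v \<in> carrier_vec n" by (rule mult_mat_vec_carrier[of _ n n]) simp_all
  have "?P $$ (0, 0) = of_nat (card {i \<in> {..<n}. f i = f j}) / of_nat n"
    using n by (simp add: index_fourier_mat sum.If_cases Int_def)
  moreover have "card {i \<in> {..<n}. f i = f j} \<noteq> 0" using assms by auto
  ultimately have "?P $$ (0, 0) \<noteq> 0" using n by simp
  moreover have "?v $ 0 = ?P $$ (0, 0)" using n by simp
  ultimately have "?v \<noteq> 0\<^sub>v n" using n by (metis index_zero_vec(1))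
  moreover have "fourier_mat n f *\<^sub>v ?v = f j \<cdot>\<^sub>v ?v"
  proof -
    have "fourier_mat n f *\<^sub>v ?v = (fourier_mat n f * ?P) *\<^sub>v unit_vec n 0"
      by (rule assoc_mult_mat_vec[of _ n n _ n, symmetric]) simp_all
    also have "fourier_mat n f * ?P = f j \<cdot>\<^sub>m ?P"
      unfolding fourier_mat_mult[OF n] fourier_mat_smult
      by (rule arg_cong[where f = "fourier_mat n"]) auto
    also have "(f j \<cdot>\<^sub>m ?P) *\<^sub>v unit_vec n 0 = f j \<cdot>\<^sub>v ?v"
      by (intro eq_vecI) auto
    finally show ?thesis .
  qed
  ultimately show ?thesis
    unfolding eigenvalue_def eigenvector_def using v by auto
qed

text \<open>Needed for the definite description in \<open>spectral_idempotent\<close>. The vector Qv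
  - Pv lies in the eigenspace, but it is also (v - Pv) - (v - Qv), a difference of vectors
  orthogonal to the eigenspace; so it is orthogonal to itself.\<close>

lemma is_orth_projection_eigenspace_unique:
  fixes A :: "complex mat"
  assumes A: "A \<in> carrier_mat n n"
    and P: "is_orth_projection n (eigenspace A \<theta>) P"
    and Q: "is_orth_projection n (eigenspace A \<theta>) Q"
  shows "P = Q"
proof -
  have carr: "P \<in> carrier_mat n n" "Q \<in> carrier_mat n n"
    using P Q by (auto simp: is_orth_projection_def)
  have eq: "P *\<^sub>v v = Q *\<^sub>v v" if v: "v \<in> carrier_vec n" for v
  proof -
    let ?w = "Q *\<^sub>v v - P *\<^sub>v v"
    have Pv: "P *\<^sub>v v \<in> carrier_vec n" and Qv: "Q *\<^sub>v v \<in> carrier_vec n"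
      using carr v by auto
    have "P *\<^sub>v v \<in> eigenspace A \<theta>" "Q *\<^sub>v v \<in> eigenspace A \<theta>"
      using P Q v by (auto simp: is_orth_projection_def)
    then have "A *\<^sub>v ?w = \<theta> \<cdot>\<^sub>v (Q *\<^sub>v v) - \<theta> \<cdot>\<^sub>v (P *\<^sub>v v)"
      using mult_minus_distrib_mat_vec[OF A Qv Pv] by (simp add: eigenspace_def)
    also have "\<dots> = \<theta> \<cdot>\<^sub>v ?w"
      using carr Pv Qv by (intro eq_vecI) (auto simp: right_diff_distrib)
    finally have w: "?w \<in> eigenspace A \<theta>"
      using A Pv Qv by (auto simp: eigenspace_def)
    have cw: "conjugate ?w \<in> carrier_vec n" using Pv Qv by auto
    have "?w \<bullet>c ?w = ((v - P *\<^sub>v v) - (v - Q *\<^sub>v v)) \<bullet>c ?w"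
      using v Pv Qv carr by (intro arg_cong[where f = "\<lambda>u. u \<bullet>c ?w"] eq_vecI) auto
    also have "\<dots> = (v - P *\<^sub>v v) \<bullet>c ?w - (v - Q *\<^sub>v v) \<bullet>c ?w"
      using v Pv Qv cw by (intro minus_scalar_prod_distrib[of _ n]) auto
    also have "\<dots> = 0"
      using P Q v w by (auto simp: is_orth_projection_def)
    finally have "?w = 0\<^sub>v n"
      using Pv Qv conjugate_square_eq_0_vec[of ?w n] by auto
    then have "?w $ i = 0" if "i < n" for i using that by simp
    then show ?thesis
      using Pv Qv carr by (intro eq_vecI) auto
  qed
  show ?thesis
  proof (rule eq_matI)
    fix i j assume "i < dim_row Q" "j < dim_col Q"
    then have "i < n" "j < n" using carr by auto
    moreover from this have "(P *\<^sub>v unit_vec n j) $ i = (Q *\<^sub>v unit_vec n j) $ i"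
      by (simp add: eq)
    ultimately show "P $$ (i, j) = Q $$ (i, j)" using carr by auto
  qed (use carr in auto)
qed

text \<open>With A the matrix and P the candidate, AP = \<theta>P puts the range of P into the
  eigenspace. Since P is self-adjoint and fixes each eigenvector w, the inner products of Pv and v
  with w agree.\<close>

lemma is_orth_projection_fourier_mat:
  assumes n: "n > 0"
  shows "is_orth_projection n (eigenspace (fourier_mat n f) \<theta>)
           (fourier_mat n (\<lambda>j. if f j = \<theta> then 1 else 0))"
  unfolding is_orth_projection_def
proof (intro conjI ballI)
  let ?A = "fourier_mat n f" and ?P = "fourier_mat n (\<lambda>j. if f j = \<theta> then 1 else 0)"
  show "?P \<in> carrier_mat n n" by simp
  fix v :: "complex vec" assume v: "v \<in> carrier_vec n"
  have carr: "fourier_mat n g *\<^sub>v u \<in> carrier_vec n" for g u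
    by (rule carrier_vecI) simp
  have "?A *\<^sub>v (?P *\<^sub>v v) = (?A * ?P) *\<^sub>v v"
    using v by (intro assoc_mult_mat_vec[of _ n n _ n, symmetric]) auto
  also have "?A * ?P = \<theta> \<cdot>\<^sub>m ?P"
    unfolding fourier_mat_mult[OF n] fourier_mat_smult
    by (rule arg_cong[where f = "fourier_mat n"]) auto
  also have "(\<theta> \<cdot>\<^sub>m ?P) *\<^sub>v v = \<theta> \<cdot>\<^sub>v (?P *\<^sub>v v)"
    using v by (intro eq_vecI) auto
  finally show "?P *\<^sub>v v \<in> eigenspace ?A \<theta>"
    by (simp add: eigenspace_def carr)
  fix w assume "w \<in> eigenspace ?A \<theta>"
  then have w: "w \<in> carrier_vec n" "?A *\<^sub>v w = \<theta> \<cdot>\<^sub>v w"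
    by (auto simp: eigenspace_def)
  txt \<open>On the other characters \<open>A - \<theta>\<close> is invertible, so \<open>P\<close> fixes every eigenvector.\<close>
  let ?G = "fourier_mat n (\<lambda>j. if f j = \<theta> then 0 else 1 / (f j - \<theta>))"
  have "1\<^sub>m n - ?P = ?G * (?A - \<theta> \<cdot>\<^sub>m 1\<^sub>m n)"
    unfolding fourier_mat_one[OF n, symmetric] fourier_mat_smult fourier_mat_diff
      fourier_mat_mult[OF n]
    by (rule arg_cong[where f = "fourier_mat n"]) auto
  then have "(1\<^sub>m n - ?P) *\<^sub>v w = ?G *\<^sub>v ((?A - \<theta> \<cdot>\<^sub>m 1\<^sub>m n) *\<^sub>v w)"
    using w by (simp add: assoc_mult_mat_vec[of _ n n _ n] minus_carrier_mat)
  also have "(?A - \<theta> \<cdot>\<^sub>m 1\<^sub>m n) *\<^sub>v w = ?A *\<^sub>v w - (\<theta> \<cdot>\<^sub>m 1\<^sub>m n) *\<^sub>v w"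
    using w by (intro minus_mult_distrib_mat_vec[of _ n n]) auto
  also have "(\<theta> \<cdot>\<^sub>m 1\<^sub>m n) *\<^sub>v w = \<theta> \<cdot>\<^sub>v w"
    using w by (intro eq_vecI) auto
  also have "?A *\<^sub>v w - \<theta> \<cdot>\<^sub>v w = 0\<^sub>v n"
    using w by auto
  also have "?G *\<^sub>v 0\<^sub>v n = 0\<^sub>v n"
    by (intro eq_vecI) auto
  finally have "w - ?P *\<^sub>v w = 0\<^sub>v n"
    using w minus_mult_distrib_mat_vec[of "1\<^sub>m n" n n ?P w] by simp
  then have "(w - ?P *\<^sub>v w) $ i = 0" if "i < n" for i using that by simp
  then have Pw: "?P *\<^sub>v w = w"
    using w by (intro eq_vecI) auto
  have "(?P *\<^sub>v v) \<bullet>c w = v \<bullet>c (?P *\<^sub>v w)"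
    using fourier_mat_adjoint[OF v w(1), of "\<lambda>j. if f j = \<theta> then 1 else 0"]
    by (simp add: if_distrib cong: if_cong)
  then show "(v - ?P *\<^sub>v v) \<bullet>c w = 0"
    using v w carr by (simp add: minus_scalar_prod_distrib[of _ n] Pw)
qed

lemma spectral_idempotent_fourier_mat:
  assumes "n > 0"
  shows "spectral_idempotent (fourier_mat n f) \<theta>
           = fourier_mat n (\<lambda>j. if f j = \<theta> then 1 else 0)"
  unfolding spectral_idempotent_def
proof (rule the_equality)
  show "is_orth_projection (dim_row (fourier_mat n f)) (eigenspace (fourier_mat n f) \<theta>)
      (fourier_mat n (\<lambda>j. if f j = \<theta> then 1 else 0))"
    using is_orth_projection_fourier_mat[OF assms] by simp
next
  fix P assume "is_orth_projection (dim_row (fourier_mat n f)) (eigenspace (fourier_mat n f) \<theta>) P"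
  then show "P = fourier_mat n (\<lambda>j. if f j = \<theta> then 1 else 0)"
    using is_orth_projection_eigenspace_unique[OF fourier_mat_carrier _
        is_orth_projection_fourier_mat[OF assms]] by simp
qed

section \<open>Linear independence of exponentials and zero transfer\<close>

text \<open>Vanishing moments annihilate every polynomial in \<mu>; a polynomial that vanishes at
  all values of \<mu> other than \<theta> isolates one fibre.\<close>

lemma fibre_sums_zero_if_moments_zero:
  fixes d \<mu> :: "'i \<Rightarrow> complex"
  assumes fin: "finite J" and mom: "\<And>m. (\<Sum>j\<in>J. d j * \<mu> j ^ m) = 0"
  shows "(\<Sum>j | j \<in> J \<and> \<mu> j = \<theta>. d j) = 0"
proof -
  \<comment> \<open>A Lagrange polynomial without normalisation: only \<open>poly p \<theta>\<close>
    being nonzero matters, as it is divided out at the end.\<close>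
  define p where "p = (\<Prod>x\<in>\<mu> ` J - {\<theta>}. [:- x, 1:])"
  have "(\<Sum>j\<in>J. d j * poly p (\<mu> j)) = (\<Sum>m\<le>degree p. coeff p m * (\<Sum>j\<in>J. d j * \<mu> j ^ m))"
    unfolding poly_altdef sum_distrib_left by (subst sum.swap) (simp add: mult_ac)
  then have "0 = (\<Sum>j\<in>J. d j * poly p (\<mu> j))"
    by (simp add: mom)
  also have "\<dots> = (\<Sum>j\<in>J. if \<mu> j = \<theta> then d j * poly p \<theta> else 0)"
  proof (intro sum.cong refl)
    fix j assume "j \<in> J"
    then have "\<mu> j \<noteq> \<theta> \<Longrightarrow> poly p (\<mu> j) = 0"
      unfolding p_def poly_prod using fin by (intro prod_zero) auto
    then show "d j * poly p (\<mu> j) = (if \<mu> j = \<theta> then d j * poly p \<theta> else 0)" by auto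
  qed
  also have "\<dots> = (\<Sum>j | j \<in> J \<and> \<mu> j = \<theta>. d j) * poly p \<theta>"
    using fin by (simp add: sum.inter_filter[symmetric] sum_distrib_right)
  finally show ?thesis
    using fin by (auto simp: p_def poly_prod)
qed

text \<open>Forward, repeated differentiation at a positive time yields vanishing moments for the
  weights \<open>c j * exp (- \<i> * t * \<mu> j)\<close>, and the exponential is constant on each
  fibre of \<mu>. Backward, the sum is grouped by fibres.\<close>

lemma exp_sum_zero_iff:
  fixes c \<mu> :: "'i \<Rightarrow> complex"
  assumes fin: "finite J"
  shows "(\<forall>t\<ge>0::real. (\<Sum>j\<in>J. c j * exp (- \<i> * of_real t * \<mu> j)) = 0)
     \<longleftrightarrow> (\<forall>\<theta>. (\<Sum>j | j \<in> J \<and> \<mu> j = \<theta>. c j) = 0)" (is "?L \<longleftrightarrow> ?R")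
proof
  assume L: ?L
  \<comment> \<open>Up to the factor (-i)^m, this is the m-th derivative of the given sum.\<close>
  define F where "F m t = (\<Sum>j\<in>J. c j * \<mu> j ^ m * exp (- \<i> * of_real t * \<mu> j))" for m and t :: real
  \<comment> \<open>The inequality is strict because a two-sided derivative needs the function to
    vanish on an open neighbourhood of \<open>t\<close>.\<close>
  have F: "F m t = 0" if "t > 0" for m t
    using that
  proof (induction m arbitrary: t)
    case 0
    then show ?case using L by (simp add: F_def)
  next
    case (Suc m)
    have "(F m has_vector_derivative - \<i> * F (Suc m) t) (at t)"
    proof -
      have "((\<lambda>z. \<Sum>j\<in>J. c j * \<mu> j ^ m * exp (- \<i> * z * \<mu> j)) has_field_derivative
          - \<i> * F (Suc m) t) (at (of_real t))"
        unfolding F_def sum_distrib_left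
        by (rule DERIV_sum) (auto intro!: derivative_eq_intros simp: algebra_simps)
      from has_vector_derivative_real_field[OF this] show ?thesis
        by (simp add: F_def[abs_def])
    qed
    moreover have "(F m has_vector_derivative 0) (at t)"
      by (rule has_vector_derivative_transform_within_open[of "\<lambda>_. 0" _ _ "{0<..}"])
         (use Suc in auto)
    ultimately have "- \<i> * F (Suc m) t = 0"
      by (rule vector_derivative_unique_at)
    then show ?case by simp
  qed
  show ?R
  proof
    fix \<theta>
    have "(\<Sum>j | j \<in> J \<and> \<mu> j = \<theta>. c j * exp (- \<i> * \<mu> j)) = 0"
      \<comment> \<open>Time 1 is an arbitrary positive choice; the resulting factor
        \<open>exp (- \<i> * \<theta>)\<close> is nonzero and cancels.\<close>
      using F[of 1] by (intro fibre_sums_zero_if_moments_zero[OF fin]) (simp add: F_def mult_ac)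
    also have "(\<Sum>j | j \<in> J \<and> \<mu> j = \<theta>. c j * exp (- \<i> * \<mu> j))
        = (\<Sum>j | j \<in> J \<and> \<mu> j = \<theta>. c j) * exp (- \<i> * \<theta>)"
      unfolding sum_distrib_right by (intro sum.cong) auto
    finally show "(\<Sum>j | j \<in> J \<and> \<mu> j = \<theta>. c j) = 0" by simp
  qed
next
  assume R: ?R
  show ?L
  proof (intro allI impI)
    fix t :: real
    have "(\<Sum>j\<in>J. c j * exp (- \<i> * of_real t * \<mu> j))
        = (\<Sum>\<theta>\<in>\<mu> ` J. \<Sum>j | j \<in> J \<and> \<mu> j = \<theta>. c j * exp (- \<i> * of_real t * \<mu> j))"
      by (rule sum.image_gen[OF fin])
    also have "\<dots> = (\<Sum>\<theta>\<in>\<mu> ` J. (\<Sum>j | j \<in> J \<and> \<mu> j = \<theta>. c j) * exp (- \<i> * of_real t * \<theta>))"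
      unfolding sum_distrib_right by (intro sum.cong) auto
    also have "\<dots> = 0" using R by simp
    finally show "(\<Sum>j\<in>J. c j * exp (- \<i> * of_real t * \<mu> j)) = 0" .
  qed
qed

lemma zero_transfer_fourier_mat:
  assumes "u < n" "v < n"
  shows "zero_transfer (fourier_mat n f) u v
     \<longleftrightarrow> (\<forall>\<theta>. spectral_idempotent (fourier_mat n f) \<theta> $$ (u, v) = 0)"
proof -
  have n: "n > 0" using assms by simp
  let ?e = "\<lambda>j. zn_char n (int j * (int u - int v))"
  have "transition_mat (fourier_mat n f) t $$ (u, v)
      = (\<Sum>j<n. ?e j * exp (- \<i> * of_real t * f j)) / of_nat n" for t
    using assms n
    by (simp add: transition_mat_def fourier_mat_smult mat_exp_fourier_mat index_fourier_mat
        mult.commute)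
  moreover have "spectral_idempotent (fourier_mat n f) \<theta> $$ (u, v)
      = (\<Sum>j | j \<in> {..<n} \<and> f j = \<theta>. ?e j) / of_nat n" for \<theta>
    using assms n
    by (simp add: spectral_idempotent_fourier_mat index_fourier_mat sum.inter_filter[symmetric]
        if_distrib[where f = "\<lambda>x. x * _"] cong: if_cong)
  ultimately show ?thesis
    using n exp_sum_zero_iff[of "{..<n}" ?e f] by (simp add: zero_transfer_def)
qed

section \<open>The entry at (n/4, 0) as a count of residues modulo 4\<close>

lemma i_power_mod_4: "\<i> ^ j = (if j mod 4 = 0 then 1 else if j mod 4 = 1 then \<i>
    else if j mod 4 = 2 then - 1 else - \<i>)"
proof -
  have "\<i> ^ j = \<i> ^ (4 * (j div 4) + j mod 4)" by simp
  also have "\<dots> = \<i> ^ (j mod 4)"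
    by (simp only: power_add power_mult) simp
  finally have eq: "\<i> ^ j = \<i> ^ (j mod 4)" .
  have "j mod 4 \<in> {0, 1, 2, 3}" by auto
  then show ?thesis
    unfolding eq by (auto simp: power3_eq_cube)
qed

lemma sum_i_power:
  assumes "finite M"
  shows "(\<Sum>j\<in>M. \<i> ^ j) = Complex
    (real (card {j \<in> M. j mod 4 = 0}) - real (card {j \<in> M. j mod 4 = 2}))
    (real (card {j \<in> M. j mod 4 = 1}) - real (card {j \<in> M. j mod 4 = 3}))"
proof -
  have count: "(\<Sum>j\<in>M. if j mod 4 = r then 1 else 0) = complex_of_nat (card {j \<in> M. j mod 4 = r})" for r
    using assms by (simp add: sum.inter_filter[symmetric])
  have "\<i> ^ j = (if j mod 4 = 0 then 1 else 0) - (if j mod 4 = 2 then 1 else 0)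
      + \<i> * ((if j mod 4 = 1 then 1 else 0) - (if j mod 4 = 3 then 1 else 0))" for j
  proof -
    have "j mod 4 \<in> {0, 1, 2, 3}" by auto
    then show ?thesis unfolding i_power_mod_4[of j] by auto
  qed
  then have "(\<Sum>j\<in>M. \<i> ^ j)
      = (of_nat (card {j \<in> M. j mod 4 = 0}) - of_nat (card {j \<in> M. j mod 4 = 2}))
      + \<i> * (of_nat (card {j \<in> M. j mod 4 = 1}) - of_nat (card {j \<in> M. j mod 4 = 3}))"
    by (simp only: sum.distrib sum_subtractf sum_distrib_left[symmetric] count)
  then show ?thesis by (simp add: complex_eq_iff)
qed

lemma spectral_idempotent_quarter:
  assumes "n > 0" "n mod 4 = 0"
  shows "spectral_idempotent (fourier_mat n (circ_ev n C)) \<theta> $$ (n div 4, 0)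
    = (\<Sum>j\<in>index_set n C \<theta>. \<i> ^ j) / of_nat n"
proof -
  have "real (n div 4) = real n / 4" using assms(2) by (auto elim!: evenE simp: mod_eq_0_iff_dvd)
  then have ang: "2 * pi * real_of_int (int j * int (n div 4)) / real n = real j * (pi / 2)" for j
    using assms(1) by (simp add: field_simps)
  have "zn_char n (int j * int (n div 4)) = \<i> ^ j" for j
    unfolding zn_char_def ang using Complex.DeMoivre[of "pi / 2" j] by simp
  then show ?thesis
    using assms(1)
    by (simp add: spectral_idempotent_fourier_mat index_fourier_mat index_set_def
        lessThan_atLeast0 sum.inter_filter[symmetric] if_distrib[where f = "\<lambda>x. x * _"] cong: if_cong)
qed

section \<open>The reflection of the index sets\<close>

text \<open>Adding \<open>n - j\<close> instead of subtracting \<open>j\<close> avoids truncated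
  subtraction on the naturals.\<close>

definition half_reflect :: "nat \<Rightarrow> nat \<Rightarrow> nat" where
  "half_reflect n j = (n div 2 + (n - j)) mod n"

lemma int_half_reflect:
  assumes "j < n"
  shows "int (half_reflect n j) = (int (n div 2) - int j) mod int n"
proof -
  have "int (half_reflect n j) = (int (n div 2) - int j + int n) mod int n"
    using assms by (simp add: half_reflect_def zmod_int of_nat_diff algebra_simps)
  then show ?thesis by simp
qed

lemma half_reflect_less: "j < n \<Longrightarrow> half_reflect n j < n"
  by (simp add: half_reflect_def)

lemma half_reflect_involutive:
  assumes "j < n"
  shows "half_reflect n (half_reflect n j) = j"
proof -
  have "int (half_reflect n (half_reflect n j)) = (int (n div 2) - (int (n div 2) - int j)) mod int n"
    using assms by (simp add: int_half_reflect half_reflect_less mod_diff_right_eq)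
  then show ?thesis using assms by simp
qed

text \<open>For odd k the character at k(n/2) is -1, so the reflection sends w^(jk) to -w^(-jk),
  where w is the root of unity, and exchanges the two terms of each summand. In terms of sines,
  sin(pi k - x) = sin x.\<close>

lemma circ_ev_half_reflect:
  assumes j: "j < n" and "even n" and odd: "\<forall>c\<in>C. odd c"
  shows "circ_ev n C (half_reflect n j) = circ_ev n C j"
proof -
  have n: "n > 0" using j by simp
  have "zn_char n (int (n div 2) * int k) = - 1" if "odd k" for k
  proof -
    obtain m where m: "n = 2 * m" "m > 0" using \<open>even n\<close> n by auto
    have "zn_char n (int (n div 2)) = - 1" using m by (simp add: zn_char_def)
    then show ?thesis
      using that zn_char_power[of n "int (n div 2)" k] by (simp add: mult.commute)
  qed
  moreover have "int n dvd int (half_reflect n j) * int k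
      - (int (n div 2) * int k + - (int j * int k))" for k
  proof -
    have "int n dvd int (half_reflect n j) - (int (n div 2) - int j)"
      using j by (simp add: int_half_reflect mod_eq_dvd_iff[symmetric])
    then have "int n dvd (int (half_reflect n j) - (int (n div 2) - int j)) * int k"
      by (rule dvd_mult2)
    then show ?thesis by (simp add: algebra_simps)
  qed
  ultimately have "zn_char n (int (half_reflect n j) * int k) = - zn_char n (- (int j * int k))"
    if "odd k" for k
    using zn_char_cong[OF n] that by (metis mult_minus1 zn_char_add)
  then show ?thesis
    using odd unfolding circ_ev_zn_char
    by (intro arg_cong[where f = "\<lambda>x. \<i> * x"] sum.cong) (auto simp: zn_char_uminus)
qed

lemma half_reflect_add_mod_4:
  assumes "j < n" "n mod 4 = 0"
  shows "(half_reflect n j + j) mod 4 = n div 2 mod 4"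
proof -
  have "4 dvd n" using assms(2) by (simp add: mod_eq_0_iff_dvd)
  then have "(half_reflect n j + j) mod 4 = ((half_reflect n j + j) mod n) mod 4"
    by (simp add: mod_mod_cancel)
  also have "(half_reflect n j + j) mod n = (n div 2 + n) mod n"
    using assms(1) by (simp add: half_reflect_def mod_add_left_eq)
  also have "\<dots> mod 4 = n div 2 mod 4"
    using \<open>4 dvd n\<close> by (simp add: mod_mod_cancel)
  finally show ?thesis .
qed

text \<open>The hypothesis \<open>swap\<close> isolates the arithmetic modulo 4: residues adding up
  to that of n/2 exchange the classes \<open>r\<close> and \<open>s\<close>. Applied in both orders,
  it makes the reflection a bijection between the classes, with itself as inverse.\<close>

lemma card_index_set_half_reflect:
  assumes n: "n mod 4 = 0" and odd: "\<forall>c\<in>C. odd c"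
    and swap: "\<And>x y. (x + y) mod 4 = n div 2 mod 4 \<Longrightarrow> x mod 4 = s \<longleftrightarrow> y mod 4 = r"
  shows "card {j \<in> index_set n C \<theta>. j mod 4 = r} = card {j \<in> index_set n C \<theta>. j mod 4 = s}"
proof (rule bij_betw_same_card)
  have "even n" using n by presburger
  then have mem: "half_reflect n j \<in> index_set n C \<theta>" if "j \<in> index_set n C \<theta>" for j
    using that odd by (simp add: index_set_def half_reflect_less circ_ev_half_reflect)
  have invol: "half_reflect n (half_reflect n j) = j" if "j \<in> index_set n C \<theta>" for j
    using that by (simp add: index_set_def half_reflect_involutive)
  have iff: "half_reflect n j mod 4 = s \<longleftrightarrow> j mod 4 = r"
    "j mod 4 = s \<longleftrightarrow> half_reflect n j mod 4 = r" if "j \<in> index_set n C \<theta>" for j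
    using that half_reflect_add_mod_4[OF _ n, of j]
      swap[of "half_reflect n j" j] swap[of j "half_reflect n j"]
    by (simp_all add: index_set_def add.commute)
  show "bij_betw (half_reflect n) {j \<in> index_set n C \<theta>. j mod 4 = r}
      {j \<in> index_set n C \<theta>. j mod 4 = s}"
    by (rule bij_betw_byWitness[where f' = "half_reflect n"]) 
       (simp_all add: image_subset_iff mem invol iff(1) iff(2)[symmetric])
qed

section \<open>Combining the counts with the reflection\<close>

theorem theorem4p5:
  fixes n :: nat and C :: "nat set"
  assumes "connected_oriented_circulant n C"
    and "n mod 4 = 0"
    and "\<forall>c\<in>C. odd c"
  shows
    "(n mod 8 = 4 \<longrightarrow>
        (\<forall>\<theta>. eigenvalue (hermitian_adj n C) \<theta> \<longrightarrow>
           Re (spectral_idempotent (hermitian_adj n C) \<theta> $$ (n div 4, 0)) = 0) \<and>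
        (zero_transfer (hermitian_adj n C) (n div 4) 0 \<longleftrightarrow>
          (\<forall>\<theta>. eigenvalue (hermitian_adj n C) \<theta> \<longrightarrow>
             card {j \<in> index_set n C \<theta>. j mod 4 = 1} = card {j \<in> index_set n C \<theta>. j mod 4 = 3}))) \<and>
     (n mod 8 = 0 \<longrightarrow>
        (\<forall>\<theta>. eigenvalue (hermitian_adj n C) \<theta> \<longrightarrow>
           Im (spectral_idempotent (hermitian_adj n C) \<theta> $$ (n div 4, 0)) = 0) \<and>
        (zero_transfer (hermitian_adj n C) (n div 4) 0 \<longleftrightarrow>
          (\<forall>\<theta>. eigenvalue (hermitian_adj n C) \<theta> \<longrightarrow>
             card {j \<in> index_set n C \<theta>. j mod 4 = 0} = card {j \<in> index_set n C \<theta>. j mod 4 = 2})))"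
proof -
  have n: "n > 0" and C: "C \<subseteq> {0..<n}" "C \<inter> zn_uminus_set n C = {}"
    using assms(1) by (auto simp: connected_oriented_circulant_def)
  let ?H = "hermitian_adj n C" and ?E = "spectral_idempotent (hermitian_adj n C)"
  let ?N = "\<lambda>\<theta> r. card {j \<in> index_set n C \<theta>. j mod 4 = r}"
  have H: "?H = fourier_mat n (circ_ev n C)"
    using hermitian_adj_fourier[OF C n] .
  have fin: "finite (index_set n C \<theta>)" for \<theta>
    by (simp add: index_set_def)
  have Re: "Re (?E \<theta> $$ (n div 4, 0)) = (real (?N \<theta> 0) - real (?N \<theta> 2)) / real n"
    and Im: "Im (?E \<theta> $$ (n div 4, 0)) = (real (?N \<theta> 1) - real (?N \<theta> 3)) / real n" for \<theta>
    by (simp_all add: H spectral_idempotent_quarter[OF n assms(2)] sum_i_power[OF fin])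
  have zero: "zero_transfer ?H (n div 4) 0 \<longleftrightarrow> (\<forall>\<theta>. ?N \<theta> 0 = ?N \<theta> 2 \<and> ?N \<theta> 1 = ?N \<theta> 3)"
  proof -
    have "zero_transfer ?H (n div 4) 0 \<longleftrightarrow> (\<forall>\<theta>. ?E \<theta> $$ (n div 4, 0) = 0)"
      using n by (simp add: H zero_transfer_fourier_mat)
    then show ?thesis using n by (simp add: complex_eq_iff Re Im)
  qed
  \<comment> \<open>Both counts are 0 when \<theta> is not an eigenvalue, so quantifying over all
    \<theta> or over eigenvalues gives the same condition.\<close>
  have "index_set n C \<theta> = {}" if "\<not> eigenvalue ?H \<theta>" for \<theta>
    using that eigenvalue_fourier_mat[of _ n "circ_ev n C"] by (auto simp: H index_set_def)
  then have counts: "(\<forall>\<theta>. eigenvalue ?H \<theta> \<longrightarrow> ?N \<theta> r = ?N \<theta> s) \<longleftrightarrow> (\<forall>\<theta>. ?N \<theta> r = ?N \<theta> s)"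
    for r s by fastforce
  show ?thesis
  proof (intro conjI impI)
    assume "n mod 8 = 4"
    \<comment> \<open>Classes 0 and 2 now balance, so in \<open>zero\<close> only the condition on
      classes 1 and 3 survives; the other case is dual.\<close>
    then have "n div 2 mod 4 = 2" by presburger
    then have N: "?N \<theta> 0 = ?N \<theta> 2" for \<theta>
      by (intro card_index_set_half_reflect[OF assms(2,3)], simp only:) presburger
    then show "\<forall>\<theta>. eigenvalue ?H \<theta> \<longrightarrow> Re (?E \<theta> $$ (n div 4, 0)) = 0"
      and "zero_transfer ?H (n div 4) 0 \<longleftrightarrow> (\<forall>\<theta>. eigenvalue ?H \<theta> \<longrightarrow> ?N \<theta> 1 = ?N \<theta> 3)"
      by (simp_all add: Re zero N counts)
  next
    assume "n mod 8 = 0"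
    then have "n div 2 mod 4 = 0" by presburger
    then have N: "?N \<theta> 1 = ?N \<theta> 3" for \<theta>
      by (intro card_index_set_half_reflect[OF assms(2,3)], simp only:) presburger
    then show "\<forall>\<theta>. eigenvalue ?H \<theta> \<longrightarrow> Im (?E \<theta> $$ (n div 4, 0)) = 0"
      and "zero_transfer ?H (n div 4) 0 \<longleftrightarrow> (\<forall>\<theta>. eigenvalue ?H \<theta> \<longrightarrow> ?N \<theta> 0 = ?N \<theta> 2)"
      by (simp_all add: Im zero N counts)
  qed
qed

end
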